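(* Let $\phi\colon\mathbb{R}^2\to\mathbb{R}^{1+2}$, $\phi(s,t)=(t,\gamma(s,t))$, be a $C^1$ evolution by isothermal gauge of initial data $(\mathcal{C},V)$, where $\mathcal{C}\colon\mathbb{R}\to\{x^0=0\}\subseteq\mathbb{R}^{1+2}$ is a $C^1$ proper immersion and $V$ is a continuous future-directed timelike vector field along $\mathcal{C}$, and write $U_0\colon\mathbb{R}\to S^1$ for the unit tangent vector along the initial curve $\gamma(\cdot,0)$. Suppose that $\mathrm{Im}(U_0)$ contains an arc of length $>\pi$ (for example if $\gamma(\cdot,0)$ is self-intersecting). Then there exists a time $t_*\in\mathbb{R}$ such that: either $\mathrm{Im}(\gamma(\cdot,t_* ))$ is not a $C^1$ immersed curve; or $\mathrm{Im}(\gamma(\cdot,t_* ))$ is a $C^1$ immersed curve, but the spatial unit tangent $U(\cdot,t_* )=\gamma_s(\cdot,t_* )/|\gamma_s(\cdot,t_* )|$ (defined only on the set $\{s\colon\gamma_s(s,t_* )\neq0\}$) admits no extension to a continuous unit tangent vector field along $\gamma(\cdot,t_* )$.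
   Context: $\mathbb{R}^{1+2}$ is $\mathbb{R}^3$ with coordinates $(x^0,x^1,x^2)$ and the Minkowski metric $\eta=-(dx^0)^2+(dx^1)^2+(dx^2)^2$. Evolution by isothermal gauge: replacing $V$ by another field spanning the same planes together with $\dot{\mathcal{C}}$, and reparametrising $\mathcal{C}$, the data are put in the normalised form $\mathcal{C}(s)=(0,c(s))$, $V(s)=(1,v(s))$, where $c\colon\mathbb{R}\to\mathbb{R}^2$ is a $C^1$ proper immersion, $v\colon\mathbb{R}\to\mathbb{R}^2$ is continuous, and $\langle\dot c(s),v(s)\rangle=0$, $|\dot c(s)|^2+|v(s)|^2=1$ (so $|v|<1$). Then the evolution is $\phi(s,t)=(t,\gamma(s,t))$ with $$\gamma(s,t)=\tfrac12\Big(c(s+t)+c(s-t)+\int_{s-t}^{s+t}v(\zeta)\,d\zeta\Big).$$ $U_0(s)=\dot c(s)/|\dot c(s)|$. Writing $U_0(s)=(\cos\vartheta(s),\sin\vartheta(s))$ with $\vartheta$ continuous, "$\mathrm{Im}(U_0)$ contains an arc of length $>\pi$" means there exist $s_1,s_2\in\mathbb{R}$ with $\vartheta(s_2)-\vartheta(s_1)>\pi$. A subset of $\mathbb{R}^2$ is a $C^1$ immersed curve if it is the image of a $C^1$ immersion of an interval. A continuous unit tangent vector field along $\gamma(\cdot,t_* )$ is a continuous map $\hat U\colon\mathbb{R}\to S^1$ such that, for each $s$, $\hat U(s)$ is tangent to the immersed curve $\mathrm{Im}(\gamma(\cdot,t_* ))$ at the point $\gamma(s,t_* )$ (to one of its branches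 through that point); it extends $U(\cdot,t_* )$ if it equals $U(s,t_* )$ wherever $\gamma_s(s,t_* )\ne0$. *)

theory Defs
  imports "HOL-Analysis.Analysis"
begin

text \<open>Minkowski space is the product of the time axis with the Euclidean plane, so that
  \<open>fst x\<close> is the coordinate \<open>x\<^sup>0\<close> and \<open>snd x\<close> is \<open>(x\<^sup>1, x\<^sup>2)\<close>.\<close>

type_synonym spacetime = "real \<times> (real^2)"

definition minkowski :: "spacetime \<Rightarrow> spacetime \<Rightarrow> real" where
  "minkowski x y = - (fst x * fst y) + snd x \<bullet> snd y"

definition future_timelike :: "spacetime \<Rightarrow> bool" where
  "future_timelike x \<longleftrightarrow> minkowski x x < 0 \<and> fst x > 0"

text \<open>Derivatives are taken within \<open>I\<close>, hence one-sided at endpoints belonging to \<open>I\<close>.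
  Only used for intervals with nonempty interior, where they are unique.\<close>

definition C1_immersion_on :: "(real \<Rightarrow> 'a::real_normed_vector) \<Rightarrow> real set \<Rightarrow> bool" where
  "C1_immersion_on f I \<longleftrightarrow>
     f differentiable_on I \<and>
     continuous_on I (\<lambda>u. vector_derivative f (at u within I)) \<and>
     (\<forall>u\<in>I. vector_derivative f (at u within I) \<noteq> 0)"

definition initial_data :: "(real \<Rightarrow> spacetime) \<Rightarrow> (real \<Rightarrow> spacetime) \<Rightarrow> bool" where
  "initial_data C V \<longleftrightarrow>
     (\<forall>s. fst (C s) = 0) \<and>
     C1_immersion_on C UNIV \<and> proper_map euclidean euclidean C \<and>
     continuous_on UNIV V \<and> (\<forall>s. future_timelike (V s))"

definition normalised_data :: "(real \<Rightarrow> real^2) \<Rightarrow> (real \<Rightarrow> real^2) \<Rightarrow> bool" where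
  "normalised_data c v \<longleftrightarrow>
     C1_immersion_on c UNIV \<and> proper_map euclidean euclidean c \<and>
     continuous_on UNIV v \<and>
     (\<forall>s. vector_derivative c (at s) \<bullet> v s = 0) \<and>
     (\<forall>s. (norm (vector_derivative c (at s)))\<^sup>2 + (norm (v s))\<^sup>2 = 1)"

text \<open>The normalised data arise from \<open>(C, V)\<close> by a reparametrisation \<open>\<sigma>\<close> of the curve (a
  \<open>C\<^sup>1\<close> diffeomorphism of the line, of either orientation) and a change of the vector field that
  keeps the planes spanned together with the tangent of the curve.\<close>

definition normal_form_of ::
  "(real \<Rightarrow> real^2) \<Rightarrow> (real \<Rightarrow> real^2) \<Rightarrow> (real \<Rightarrow> spacetime) \<Rightarrow> (real \<Rightarrow> spacetime) \<Rightarrow> bool" where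
  "normal_form_of c v C V \<longleftrightarrow>
     normalised_data c v \<and>
     (\<exists>\<sigma> :: real \<Rightarrow> real. bij \<sigma> \<and> C1_immersion_on \<sigma> UNIV \<and>
        (\<forall>s. C (\<sigma> s) = (0, c s)) \<and>
        (\<forall>s. span {V (\<sigma> s), vector_derivative C (at (\<sigma> s))} =
             span {(1, v s), (0, vector_derivative c (at s))}))"

text \<open>The interval integral is oriented, as is needed for negative \<open>t\<close>.\<close>

definition isothermal_curve ::
  "(real \<Rightarrow> real^2) \<Rightarrow> (real \<Rightarrow> real^2) \<Rightarrow> real \<Rightarrow> real \<Rightarrow> real^2" where
  "isothermal_curve c v s t =
     (1/2) *\<^sub>R (c (s + t) + c (s - t) + (LBINT \<zeta>=ereal (s - t)..ereal (s + t). v \<zeta>))"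

definition isothermal_evolution ::
  "(real \<times> real \<Rightarrow> spacetime) \<Rightarrow> (real \<Rightarrow> spacetime) \<Rightarrow> (real \<Rightarrow> spacetime) \<Rightarrow> bool" where
  "isothermal_evolution \<phi> C V \<longleftrightarrow>
     (\<exists>c v. normal_form_of c v C V \<and> (\<forall>s t. \<phi> (s, t) = (t, isothermal_curve c v s t)))"

text \<open>The function \<open>sgn\<close> normalises vectors; the unit tangent is meaningful only
  where the derivative does not vanish.\<close>

definition unit_tangent :: "(real \<Rightarrow> real^2) \<Rightarrow> real \<Rightarrow> real^2" where
  "unit_tangent g s = sgn (vector_derivative g (at s))"

text \<open>Arc length on the circle is measured on a continuous lift of the angle, so that it may
  exceed \<open>2 * pi\<close>.\<close>

definition contains_arc_longer_than :: "(real \<Rightarrow> real^2) \<Rightarrow> real \<Rightarrow> bool" where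
  "contains_arc_longer_than U L \<longleftrightarrow>
     (\<exists>\<theta> :: real \<Rightarrow> real. continuous_on UNIV \<theta> \<and>
        (\<forall>s. U s = vector [cos (\<theta> s), sin (\<theta> s)]) \<and>
        (\<exists>s1 s2. \<theta> s2 - \<theta> s1 > L))"

definition C1_immersed_parametrisation ::
  "(real \<Rightarrow> real^2) \<Rightarrow> real set \<Rightarrow> (real^2) set \<Rightarrow> bool" where
  "C1_immersed_parametrisation \<alpha> I S \<longleftrightarrow>
     is_interval I \<and> interior I \<noteq> {} \<and> C1_immersion_on \<alpha> I \<and> \<alpha> ` I = S"

definition C1_immersed_curve :: "(real^2) set \<Rightarrow> bool" where
  "C1_immersed_curve S \<longleftrightarrow> (\<exists>\<alpha> I. C1_immersed_parametrisation \<alpha> I S)"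

text \<open>The branches of an immersed curve through a point are those of an immersion \<open>\<alpha>\<close>
  parametrising it, one for each parameter value \<open>u\<close> at which \<open>\<alpha>\<close> attains the point. The immersion
  is chosen once for the whole field, the branch separately for each \<open>s\<close>.\<close>

definition unit_tangent_field_along :: "(real \<Rightarrow> real^2) \<Rightarrow> (real \<Rightarrow> real^2) \<Rightarrow> bool" where
  "unit_tangent_field_along g W \<longleftrightarrow>
     continuous_on UNIV W \<and> (\<forall>s. norm (W s) = 1) \<and>
     (\<exists>\<alpha> I. C1_immersed_parametrisation \<alpha> I (range g) \<and>
        (\<forall>s. \<exists>u\<in>I. \<alpha> u = g s \<and> W s \<in> span {vector_derivative \<alpha> (at u within I)}))"

definition extends_unit_tangent :: "(real \<Rightarrow> real^2) \<Rightarrow> (real \<Rightarrow> real^2) \<Rightarrow> bool" where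
  "extends_unit_tangent g W \<longleftrightarrow>
     (\<forall>s. vector_derivative g (at s) \<noteq> 0 \<longrightarrow> W s = unit_tangent g s)"

end

theory Submission
  imports Defs
begin

text \<open>In normalised form \<open>c' + v\<close> and \<open>c' - v\<close> are unit vectors with angles \<open>\<alpha> = \<theta> + \<psi>\<close> and
  \<open>\<beta> = \<theta> - \<psi>\<close>, where \<open>\<theta>\<close> is the angle of \<open>c'\<close> and \<open>\<bar>\<psi>\<bar> < pi / 2\<close>. Hence
  \<open>\<gamma>\<^sub>s(s, t) = m E\<close> with \<open>m = cos ((\<alpha> (s + t) - \<beta> (s - t)) / 2)\<close> and \<open>E\<close> the unit vector of angle
  \<open>(\<alpha> (s + t) + \<beta> (s - t)) / 2\<close>. Here \<open>m > 0\<close> for \<open>t = 0\<close>, while an arc longer than \<open>pi\<close>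
  forces \<open>m < 0\<close> somewhere. By connectedness of the time axis, either \<open>m\<close> vanishes identically at
  some time and the curve collapses to a point, or \<open>m\<close> changes sign along the curve for an open
  set of times. At all but countably many of the latter, \<open>E\<close> is constant on each interval where the
  curve stands still, so a continuous tangent field cannot pass from \<open>E\<close> to \<open>- E\<close>.\<close>

section \<open>Countability and constancy\<close>

text \<open>By the Lindelof property countably many of the given neighbourhoods already cover
  \<open>S\<close>.\<close>

lemma countable_image_locally:
  fixes S :: "'a::second_countable_topology set"
  assumes "\<And>x. x \<in> S \<Longrightarrow> \<exists>T. open T \<and> x \<in> T \<and> countable (f ` (S \<inter> T))"
  shows "countable (f ` S)"
proof -
  define \<F> where "\<F> = {T. open T \<and> countable (f ` (S \<inter> T))}"
  obtain \<G> where \<G>: "\<G> \<subseteq> \<F>" "countable \<G>" "\<Union>\<G> = \<Union>\<F>"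
    using Lindelof[of \<F>] by (auto simp: \<F>_def)
  have "f ` S \<subseteq> (\<Union>T\<in>\<G>. f ` (S \<inter> T))"
  proof
    fix y assume "y \<in> f ` S"
    then obtain x where x: "x \<in> S" "y = f x" by auto
    then have "x \<in> \<Union>\<G>" unfolding \<G>(3) using assms[of x] by (auto simp: \<F>_def)
    with x show "y \<in> (\<Union>T\<in>\<G>. f ` (S \<inter> T))" by auto
  qed
  moreover have "countable (\<Union>T\<in>\<G>. f ` (S \<inter> T))"
    using \<G> by (intro countable_UN) (auto simp: \<F>_def)
  ultimately show ?thesis by (rule countable_subset)
qed

text \<open>A connected subset of a metric space with two distinct points is uncountable.\<close>

lemma constant_on_countable_image:
  fixes f :: "'a::topological_space \<Rightarrow> 'b::metric_space"
  assumes "connected S" "continuous_on S f" "countable (f ` S)" "x \<in> S" "y \<in> S"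
  shows "f x = f y"
  using connected_uncountable[OF connected_continuous_image[OF assms(2,1)], of "f x" "f y"] assms
  by auto

text \<open>A nonzero derivative makes every point of the fibre isolated, and a subset of the line
  with only isolated points is countable.\<close>

lemma countable_fibre_of_immersion:
  assumes "C1_immersion_on \<alpha> I"
  shows "countable {u \<in> I. \<alpha> u = x}"
proof -
  define S where "S = {u \<in> I. \<alpha> u = x}"
  have "\<exists>T. open T \<and> u \<in> T \<and> countable (id ` (S \<inter> T))" if "u \<in> S" for u
  proof -
    define D where "D = vector_derivative \<alpha> (at u within I)"
    have u: "u \<in> I" "\<alpha> u = x" using that by (auto simp: S_def)
    have "D \<noteq> 0" using assms u by (auto simp: C1_immersion_on_def D_def)
    have "\<alpha> differentiable (at u within I)"
      using assms u by (auto simp: C1_immersion_on_def differentiable_on_def)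
    then have "(\<alpha> has_derivative (\<lambda>h. h *\<^sub>R D)) (at u within I)"
      using vector_derivative_works by (auto simp: D_def has_vector_derivative_def)
    then obtain d where d: "d > 0" "\<And>y. y \<in> I \<Longrightarrow> norm (y - u) < d \<Longrightarrow>
        norm (\<alpha> y - \<alpha> u - (y - u) *\<^sub>R D) \<le> norm D / 2 * norm (y - u)"
      unfolding has_derivative_within_alt using \<open>D \<noteq> 0\<close>
      by (meson half_gt_zero zero_less_norm_iff)
    have "S \<inter> ball u d \<subseteq> {u}"
    proof
      fix y assume "y \<in> S \<inter> ball u d"
      then have y: "y \<in> I" "\<alpha> y = \<alpha> u" "norm (y - u) < d"
        using u by (auto simp: S_def dist_norm norm_minus_commute)
      \<comment> \<open>On the fibre the increment of \<open>\<alpha>\<close> vanishes, so the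
        linear term alone must obey the error bound, which has half its slope.\<close>
      have "norm D * norm (y - u) \<le> norm D / 2 * norm (y - u)"
        using d(2)[OF y(1,3)] y(2) by (simp add: mult.commute)
      then have "norm (y - u) = 0" using \<open>D \<noteq> 0\<close> by (simp add: mult_le_cancel_right)
      then show "y \<in> {u}" by simp
    qed
    then have "countable (S \<inter> ball u d)" by (rule countable_subset) auto
    then show ?thesis using d(1) by (intro exI[of _ "ball u d"]) auto
  qed
  from countable_image_locally[OF this] show ?thesis by (simp add: S_def)
qed

text \<open>Otherwise each ball of radius \<open>d\<close> about a point of \<open>B\<close> meets
  \<open>B\<close> only in its centre, and \<open>B\<close> is locally countable.\<close>

lemma uncountable_imp_close_points:
  fixes B :: "'a::{metric_space,second_countable_topology} set"
  assumes "uncountable B" "d > 0"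
  shows "\<exists>x\<in>B. \<exists>y\<in>B. x \<noteq> y \<and> dist x y < d"
proof (rule ccontr)
  assume none: "\<not> (\<exists>x\<in>B. \<exists>y\<in>B. x \<noteq> y \<and> dist x y < d)"
  have "\<exists>T. open T \<and> x \<in> T \<and> countable (id ` (B \<inter> T))" if "x \<in> B" for x
  proof -
    have "B \<inter> ball x d \<subseteq> {x}"
    proof
      fix y assume "y \<in> B \<inter> ball x d"
      with that none have "\<not> (x \<noteq> y \<and> dist x y < d)" "dist x y < d"
        unfolding mem_ball Int_iff by blast+
      then show "y \<in> {x}" by blast
    qed
    then have "countable (B \<inter> ball x d)"
      by (rule countable_subset) simp
    then show ?thesis using assms(2) by (intro exI[of _ "ball x d"]) simp
  qed
  then have "countable (id ` B)" by (rule countable_image_locally)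
  then show False using assms(1) by simp
qed

section \<open>Choice of a good time\<close>

text \<open>Two shifts \<open>t \<noteq> t'\<close> make \<open>f\<close> periodic with period \<open>2 * (t - t')\<close> on the interval, and
  uncountably many shifts provide arbitrarily small periods.\<close>

lemma constant_of_uncountable_shifts:
  fixes f g :: "real \<Rightarrow> real"
  assumes cont: "continuous_on {a..b} f"
    and unc: "uncountable {t. \<forall>p\<in>{a..b}. f p = g (p - 2 * t) + c}"
  shows "f constant_on {a..b}"
proof -
  define B where "B = {t. \<forall>p\<in>{a..b}. f p = g (p - 2 * t) + c}"
  have shift: "f p = g (p - 2 * t) + c" if "t \<in> B" "p \<in> {a..b}" for p t
    using that unfolding B_def by blast
  have per: "f (p + 2 * (t - t')) = f p"
    if "t \<in> B" "t' \<in> B" "p \<in> {a..b}" "p + 2 * (t - t') \<in> {a..b}" for p t t'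
  proof -
    have "f (p + 2 * (t - t')) = g (p + 2 * (t - t') - 2 * t) + c"
      by (rule shift[OF that(1,4)])
    also have "p + 2 * (t - t') - 2 * t = p - 2 * t'" by simp
    also have "g (p - 2 * t') + c = f p" by (rule shift[OF that(2,3), symmetric])
    finally show ?thesis .
  qed
  have lt: "f x = f y" if xy: "x \<in> {a..b}" "y \<in> {a..b}" "x < y" for x y
  proof (rule ccontr)
    assume "f x \<noteq> f y"
    then obtain d where d: "d > 0" "\<And>z. z \<in> {a..b} \<Longrightarrow> dist z y < d \<Longrightarrow> dist (f z) (f y) < dist (f x) (f y)"
      using cont xy unfolding continuous_on_iff by (metis zero_less_dist_iff)
    obtain t t' where t: "t \<in> B" "t' \<in> B" "t' < t" "t - t' < d / 2"
    proof -
      obtain s s' where s: "s \<in> B" "s' \<in> B" "s \<noteq> s'" "dist s s' < d / 2"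
        using uncountable_imp_close_points[OF unc[folded B_def] half_gt_zero[OF d(1)]] by blast
      show thesis
      proof (cases "s < s'")
        case True
        then show thesis using that[OF s(2,1)] s(4) by (simp add: dist_real_def)
      next
        case False
        then show thesis using that[OF s(1,2)] s(3,4) by (simp add: dist_real_def)
      qed
    qed
    \<comment> \<open>Steps of length \<open>h\<close> from \<open>x\<close> keep the value
      \<open>f x\<close>. The last one not beyond \<open>y\<close> lands within \<open>h < d\<close>
      of \<open>y\<close>, where by the choice of \<open>d\<close> the value \<open>f x\<close>
      cannot occur.\<close>
    define h where "h = 2 * (t - t')"
    have h: "0 < h" "h < d" using t(3,4) by (auto simp: h_def)
    have step: "f (x + real k * h) = f x" if "x + real k * h \<le> y" for k
      using that
    proof (induction k)
      case (Suc k)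
      have "real k * h \<ge> 0" using h by simp
      with Suc.prems have le: "x + real k * h \<le> y" "x + real k * h + h \<le> y"
        using h by (auto simp: algebra_simps)
      have "f (x + real k * h + h) = f (x + real k * h)"
      proof (rule per[OF t(1,2), folded h_def])
        show "x + real k * h \<in> {a..b}" "x + real k * h + h \<in> {a..b}"
          using le xy \<open>real k * h \<ge> 0\<close> h unfolding atLeastAtMost_iff by linarith+
      qed
      then show ?case using Suc.IH le by (simp add: algebra_simps)
    qed simp
    define k where "k = nat \<lfloor>(y - x) / h\<rfloor>"
    have "(y - x) / h \<ge> 0" using xy h by simp
    then have "real k = of_int \<lfloor>(y - x) / h\<rfloor>" by (simp add: k_def)
    then have "real k \<le> (y - x) / h" "(y - x) / h < real k + 1" by linarith+
    then have k: "x + real k * h \<le> y" "y < x + real k * h + h"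
      using h by (auto simp: field_simps)
    have "real k * h \<ge> 0" using h by simp
    then have "x + real k * h \<in> {a..b}" "dist (x + real k * h) y < d"
      using k h xy unfolding atLeastAtMost_iff dist_real_def by linarith+
    then have "dist (f (x + real k * h)) (f y) < dist (f x) (f y)"
      by (rule d(2))
    then show False using step[OF k(1)] by simp
  qed
  have "f x = f a" if "x \<in> {a..b}" for x
    using lt[of a x] that by (cases "a = x") auto
  then show ?thesis unfolding constant_on_def by (intro exI[of _ "f a"] ballI)
qed

text \<open>For each \<open>t\<close> outside a countable set, the functions \<open>\<alpha> (x + t)\<close> and \<open>\<beta> (x - t)\<close> are
  constant on the intervals where \<open>m\<close> vanishes: otherwise, on a rational interval of \<open>p = x + t\<close>,
  uncountably many shifts of \<open>\<beta>\<close> would agree with a non-constant \<open>\<alpha>\<close> up to the same odd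
  multiple of \<open>pi\<close>.\<close>

lemma exists_transversal_time:
  fixes \<alpha> \<beta> :: "real \<Rightarrow> real"
  defines "m \<equiv> \<lambda>s t. cos ((\<alpha> (s + t) - \<beta> (s - t)) / 2)"
  assumes \<alpha>: "continuous_on UNIV \<alpha>" and \<beta>: "continuous_on UNIV \<beta>"
    and pos: "m s\<^sub>1 t\<^sub>1 > 0" and neg: "m s\<^sub>2 t\<^sub>2 < 0"
  obtains (null) t where "\<And>s. m s t = 0"
  | (change) t where "\<exists>s. m s t > 0" "\<exists>s. m s t < 0"
      "\<And>s. \<forall>\<^sub>F x in nhds s. m x t = 0 \<Longrightarrow>
         \<exists>T. open T \<and> s \<in> T \<and> (\<forall>x\<in>T. m x t = 0 \<and> \<alpha> (x + t) = \<alpha> (s + t) \<and> \<beta> (x - t) = \<beta> (s - t))"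
proof -
  have cont: "continuous_on UNIV (m s)" for s
    unfolding m_def by (intro continuous_intros continuous_on_compose2[OF \<alpha>] continuous_on_compose2[OF \<beta>]) auto
  define P where "P = (\<Union>s. {t. m s t > 0})"
  define N where "N = (\<Union>s. {t. m s t < 0})"
  have "open P" "open N"
    unfolding P_def N_def by (intro open_UN ballI open_Collect_less cont continuous_on_const)+
  show thesis
  proof (cases "P \<union> N = UNIV")
    case False
    then obtain t where t: "t \<notin> P" "t \<notin> N" by auto
    have "m s t = 0" for s using t by (force simp: P_def N_def not_less intro: antisym)
    then show thesis by (rule null)
  next
    case True
    have "t\<^sub>1 \<in> P" "t\<^sub>2 \<in> N" using pos neg by (auto simp: P_def N_def)
    then have "P \<inter> N \<noteq> {}"
      using connectedD[of UNIV P N] \<open>open P\<close> \<open>open N\<close> True by auto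
    \<comment> \<open>A nonempty open set of times is uncountable, so countably many bad times may
      be discarded.\<close>
    then have unc: "uncountable (P \<inter> N)"
      using \<open>open P\<close> \<open>open N\<close> uncountable_ball countable_subset
      by (metis ex_in_conv openE open_Int)
    \<comment> \<open>With \<open>p = s + t\<close> one has \<open>s - t = p - 2 * t\<close>, and
      \<open>m\<close> vanishes exactly when the two angles differ by an odd multiple of
      \<open>pi\<close>.\<close>
    define B where "B = (\<lambda>(a, b, n). {t. (\<forall>p\<in>{a..b}. \<alpha> p = \<beta> (p - 2 * t) + (2 * of_int n + 1) * pi)
        \<and> \<not> \<alpha> constant_on {a..b}})"
    have "countable (B (a, b, n))" for a b and n :: int
    proof (rule ccontr)
      assume u: "uncountable (B (a, b, n))"
      then have "uncountable {t. \<forall>p\<in>{a..b}. \<alpha> p = \<beta> (p - 2 * t) + (2 * of_int n + 1) * pi}"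
        by (rule contrapos_nn) (auto simp: B_def elim!: countable_subset[rotated])
      then have "\<alpha> constant_on {a..b}"
        by (rule constant_of_uncountable_shifts[OF continuous_on_subset[OF \<alpha> subset_UNIV]])
      then have "B (a, b, n) = {}" by (auto simp: B_def)
      with u show False by simp
    qed
    then have "countable (\<Union>(B ` (\<rat> \<times> \<rat> \<times> UNIV)))"
      by (intro countable_UN countable_SIGMA countable_rat) auto
    with unc have "\<not> P \<inter> N \<subseteq> \<Union>(B ` (\<rat> \<times> \<rat> \<times> UNIV))" by (meson countable_subset)
    then obtain t where "t \<in> P" "t \<in> N" "t \<notin> \<Union>(B ` (\<rat> \<times> \<rat> \<times> UNIV))" by blast
    then have t: "t \<in> P" "t \<in> N" "t \<notin> B (a, b, n)" if "a \<in> \<rat>" "b \<in> \<rat>" for a b n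
      using that by blast+
    show thesis
    proof (rule change)
      show "\<exists>s. m s t > 0" "\<exists>s. m s t < 0" using t(1,2)[of 0 0] by (auto simp: P_def N_def)
    next
      fix s assume "\<forall>\<^sub>F x in nhds s. m x t = 0"
      then obtain e where e: "e > 0" "\<And>x. dist x s < e \<Longrightarrow> m x t = 0"
        unfolding eventually_nhds_metric by blast
      \<comment> \<open>Rational endpoints keep the family of bad sets countable; they are so close
        to \<open>s + t\<close> that \<open>m\<close> vanishes for every \<open>p\<close> between
        them.\<close>
      obtain a where a: "a \<in> \<rat>" "s + t - e < a" "a < s + t"
        using Rats_dense_in_real[of "s + t - e" "s + t"] e by auto
      obtain b where b: "b \<in> \<rat>" "s + t < b" "b < s + t + e"
        using Rats_dense_in_real[of "s + t" "s + t + e"] e by auto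
      have st: "s + t \<in> {a..b}" using a b by simp
      define g where "g = (\<lambda>p. (\<alpha> p - \<beta> (p - 2 * t)) / 2)"
      have zero: "cos (g p) = 0" if "p \<in> {a..b}" for p
      proof -
        have "m (p - t) t = 0"
          using that a b by (intro e(2)) (simp add: dist_real_def abs_less_iff)
        then show ?thesis by (simp add: m_def g_def algebra_simps)
      qed
      \<comment> \<open>The zeros of the cosine form a countable set, so the continuous
        \<open>g\<close> stays at one of them and a single \<open>n\<close> serves the whole
        interval.\<close>
      have "g ` {a..b} \<subseteq> range (\<lambda>n::int. of_int n * pi + pi / 2)"
        using zero unfolding cos_zero_iff_int2 by blast
      then have cnt: "countable (g ` {a..b})" by (rule countable_subset) simp
      have "continuous_on {a..b} g" unfolding g_def
        by (intro continuous_intros continuous_on_compose2[OF \<alpha>] continuous_on_compose2[OF \<beta>]) auto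
      have gconst: "g p = g (s + t)" if "p \<in> {a..b}" for p
        using constant_on_countable_image[OF connected_Icc \<open>continuous_on {a..b} g\<close> cnt that st] .
      obtain n :: int where "g (s + t) = n * pi + pi / 2"
        using zero[OF st] unfolding cos_zero_iff_int2 by blast
      then have eq: "\<alpha> p = \<beta> (p - 2 * t) + (2 * of_int n + 1) * pi" if "p \<in> {a..b}" for p
        using gconst[OF that] by (simp add: g_def field_simps)
      with t(3)[OF a(1) b(1), of n] have "\<alpha> constant_on {a..b}"
        unfolding B_def by blast
      then have \<alpha>c: "\<alpha> p = \<alpha> (s + t)" if "p \<in> {a..b}" for p
        using that st unfolding constant_on_def by metis
      have \<beta>c: "\<beta> (p - 2 * t) = \<beta> (s - t)" if "p \<in> {a..b}" for p
        using eq[OF that] eq[OF st] \<alpha>c[OF that] by (simp add: algebra_simps)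
      show "\<exists>T. open T \<and> s \<in> T \<and> (\<forall>x\<in>T. m x t = 0 \<and> \<alpha> (x + t) = \<alpha> (s + t) \<and> \<beta> (x - t) = \<beta> (s - t))"
      proof (intro exI conjI ballI)
        fix x assume x: "x \<in> {a - t<..<b - t}"
        show "\<alpha> (x + t) = \<alpha> (s + t)" using x by (intro \<alpha>c) auto
        show "\<beta> (x - t) = \<beta> (s - t)" using \<beta>c[of "x + t"] x by (simp add: algebra_simps)
        show "m x t = 0" using x a b by (intro e(2)) (simp add: dist_real_def abs_less_iff)
      qed (use a b in auto)
    qed
  qed
qed

section \<open>Continuous tangent fields and changes of sign\<close>

text \<open>The function \<open>W \<bullet> E\<close> takes only countably many values, hence is constant: it is \<open>\<plusminus>1\<close> on
  the closure of \<open>{s. m s \<noteq> 0}\<close>, and where \<open>m\<close> vanishes on an interval, \<open>g\<close> rests at one point,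
  through which an immersed curve has only countably many branches.\<close>

lemma tangent_field_along_no_sign_change:
  fixes g W E :: "real \<Rightarrow> real^2"
  assumes deriv: "\<And>s. (g has_vector_derivative m s *\<^sub>R E s) (at s)"
    and E: "continuous_on UNIV E" "\<And>s. norm (E s) = 1"
    and flat: "\<And>s. \<forall>\<^sub>F x in nhds s. m x = 0 \<Longrightarrow>
      \<exists>T. open T \<and> s \<in> T \<and> (\<forall>x\<in>T. m x = 0 \<and> E x = E s)"
    and W: "unit_tangent_field_along g W" "extends_unit_tangent g W"
    and signs: "m s\<^sub>1 > 0" "m s\<^sub>2 < 0"
  shows False
proof -
  obtain \<alpha> I where contW: "continuous_on UNIV W" and normW: "\<And>s. norm (W s) = 1"
    and imm: "C1_immersion_on \<alpha> I"
    and tang: "\<And>s. \<exists>u\<in>I. \<alpha> u = g s \<and> W s \<in> span {vector_derivative \<alpha> (at u within I)}"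
    using W(1) unfolding unit_tangent_field_along_def C1_immersed_parametrisation_def by blast
  define F where "F = (\<lambda>s. W s \<bullet> E s)"
  have contF: "continuous_on UNIV F"
    unfolding F_def by (intro continuous_intros contW E)
  have F_sgn: "F s = sgn (m s)" if "m s \<noteq> 0" for s
  proof -
    have d: "vector_derivative g (at s) = m s *\<^sub>R E s" by (rule vector_derivative_at[OF deriv])
    then have "vector_derivative g (at s) \<noteq> 0" using that E(2)[of s] by auto
    then have "W s = sgn (m s *\<^sub>R E s)"
      using W(2) d by (simp add: extends_unit_tangent_def unit_tangent_def)
    then have "W s = sgn (m s) *\<^sub>R E s"
      using E(2)[of s] by (simp add: sgn_scaleR) (simp add: sgn_div_norm)
    then show ?thesis using E(2)[of s] by (simp add: F_def norm_eq_1)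
  qed
  define Z where "Z = interior {s. m s = 0}"
  have "closed {s. F s \<in> {-1, 1}}"
    using continuous_closed_preimage[OF contF closed_UNIV, of "{-1, 1}"] by (simp add: vimage_def)
  moreover have "- {s. m s = 0} \<subseteq> {s. F s \<in> {-1, 1}}"
    using F_sgn by (auto simp: sgn_if)
  ultimately have "closure (- {s. m s = 0}) \<subseteq> {s. F s \<in> {-1, 1}}" by (rule closure_minimal[rotated])
  then have off_Z: "F s \<in> {-1, 1}" if "s \<notin> Z" for s
    using that by (auto simp: Z_def closure_complement)
  have "\<exists>T. open T \<and> s \<in> T \<and> countable (F ` (Z \<inter> T))" if "s \<in> Z" for s
  proof -
    have "\<forall>\<^sub>F x in nhds s. x \<in> Z" using that by (intro eventually_nhds_in_open) (auto simp: Z_def)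
    then have "\<forall>\<^sub>F x in nhds s. m x = 0"
      by (rule eventually_mono) (use interior_subset in \<open>auto simp: Z_def\<close>)
    then obtain T where T: "open T" "s \<in> T" "\<And>x. x \<in> T \<Longrightarrow> m x = 0" "\<And>x. x \<in> T \<Longrightarrow> E x = E s"
      using flat by metis
    then obtain e where e: "e > 0" "ball s e \<subseteq> T" unfolding open_contains_ball by blast
    have "(g has_derivative (\<lambda>h. 0)) (at x within ball s e)" if "x \<in> ball s e" for x
    proof -
      have "m x = 0" using T(3) that e(2) by blast
      then show ?thesis
        using deriv[of x] by (simp add: has_vector_derivative_def has_derivative_at_withinI)
    qed
    then obtain c where "\<And>x. x \<in> ball s e \<Longrightarrow> g x = c"
      using has_derivative_zero_constant[of "ball s e" g] convex_ball by blast
    then have g: "g x = g s" if "x \<in> ball s e" for x using that e by simp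
    define D where "D = (\<lambda>u. vector_derivative \<alpha> (at u within I))"
    \<comment> \<open>A unit vector in the span of \<open>D u\<close> is \<open>sgn (D u)\<close> or
      its negative, so \<open>N\<close> holds all candidates for \<open>W\<close> while the curve
      rests at \<open>g s\<close>.\<close>
    define N where "N = (\<Union>u\<in>{u \<in> I. \<alpha> u = g s}. {sgn (D u), - sgn (D u)})"
    have "countable N"
      unfolding N_def by (intro countable_UN countable_fibre_of_immersion[OF imm]) auto
    have "W x \<in> N" if x: "x \<in> ball s e" for x
    proof -
      obtain u where u: "u \<in> I" "\<alpha> u = g s" "W x \<in> span {D u}"
        using tang[of x] g[OF x] by (auto simp: D_def)
      then obtain k where k: "W x = k *\<^sub>R D u" by (auto simp: span_singleton)
      have "W x = sgn (W x)" using normW[of x] by (simp add: sgn_div_norm)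
      also have "\<dots> = sgn k *\<^sub>R sgn (D u)" by (simp add: k sgn_scaleR)
      finally have "W x = sgn k *\<^sub>R sgn (D u)" .
      moreover have "k \<noteq> 0" using k normW[of x] by auto
      ultimately have "W x \<in> {sgn (D u), - sgn (D u)}" by (auto simp: sgn_if)
      then show ?thesis using u by (auto simp: N_def)
    qed
    \<comment> \<open>Since \<open>E\<close> is constant here, \<open>F\<close> depends on
      \<open>W\<close> alone.\<close>
    then have "F ` (Z \<inter> ball s e) \<subseteq> (\<lambda>w. w \<bullet> E s) ` N"
      using T(4) e by (auto simp: F_def)
    then have "countable (F ` (Z \<inter> ball s e))"
      by (rule countable_subset) (simp add: \<open>countable N\<close>)
    then show ?thesis using e by (intro exI[of _ "ball s e"]) auto
  qed
  then have "countable (F ` Z)" by (rule countable_image_locally)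
  moreover have "range F \<subseteq> F ` Z \<union> {-1, 1}" using off_Z by blast
  ultimately have "countable (range F)" by (meson countable_Un countable_finite countable_subset finite.intros)
  then have "F s\<^sub>1 = F s\<^sub>2" by (rule constant_on_countable_image[OF connected_UNIV contF]) auto
  then show False using F_sgn[of s\<^sub>1] F_sgn[of s\<^sub>2] signs by simp
qed

section \<open>Planar directions and angles\<close>

definition direction :: "real \<Rightarrow> real^2" where
  "direction \<theta> = vector [cos \<theta>, sin \<theta>]"

lemma direction_nth [simp]: "direction \<theta> $ 1 = cos \<theta>" "direction \<theta> $ 2 = sin \<theta>"
  by (simp_all add: direction_def)

lemma inner_direction: "direction a \<bullet> direction b = cos (a - b)"
  by (simp add: inner_vec_def sum_2 cos_diff)

lemma norm_direction [simp]: "norm (direction a) = 1"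
  by (simp add: norm_eq_1 inner_direction)

lemma continuous_on_direction [continuous_intros]:
  fixes f :: "'a::t2_space \<Rightarrow> real"
  assumes f: "continuous_on S f"
  shows "continuous_on S (\<lambda>x. direction (f x))"
proof -
  have "direction \<theta> = cos \<theta> *\<^sub>R axis 1 1 + sin \<theta> *\<^sub>R axis 2 1" for \<theta>
    by (simp add: vec_eq_iff forall_2 axis_def)
  then show ?thesis
    by (simp only:) (intro continuous_intros f)
qed

text \<open>This is the sum-to-product formula. The signed cosine absorbs zeros and reversals of the
  sum, so the bisecting direction stays continuous through them.\<close>

lemma direction_add_direction:
  "direction a + direction b = (2 * cos ((a - b) / 2)) *\<^sub>R direction ((a + b) / 2)"
  by (simp add: vec_eq_iff forall_2 cos_plus_cos sin_plus_sin)

lemma direction_add: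
  "direction (a + b) = cos b *\<^sub>R direction a + sin b *\<^sub>R direction (a + pi / 2)"
  by (simp add: vec_eq_iff forall_2 cos_add sin_add)

lemma direction_expansion:
  "x = (x \<bullet> direction a) *\<^sub>R direction a + (x \<bullet> direction (a + pi / 2)) *\<^sub>R direction (a + pi / 2)"
proof -
  have "y = cos a * (cos a * y) + sin a * (sin a * y)" for y
  proof -
    have "cos a * (cos a * y) + sin a * (sin a * y) = ((cos a)\<^sup>2 + (sin a)\<^sup>2) * y"
      by (simp only: power2_eq_square distrib_right mult.assoc)
    then show ?thesis by simp
  qed
  note this[of "x $ 1"] this[of "x $ 2"]
  then show ?thesis
    by (simp add: vec_eq_iff forall_2 inner_vec_def sum_2 cos_add sin_add algebra_simps)
qed

text \<open>Read as a nonvanishing complex function on the contractible line, \<open>U\<close> has a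
  continuous logarithm, whose imaginary part is the angle.\<close>

lemma continuous_angle_lift:
  fixes U :: "real \<Rightarrow> real^2"
  assumes "continuous_on UNIV U" "\<And>s. norm (U s) = 1"
  obtains \<theta> where "continuous_on UNIV \<theta>" "\<And>s. U s = direction (\<theta> s)"
proof -
  define z where "z = (\<lambda>s. Complex (U s $ 1) (U s $ 2))"
  have sq: "(U s $ 1)\<^sup>2 + (U s $ 2)\<^sup>2 = 1" for s
    using assms(2)[of s] by (simp add: norm_eq_1 inner_vec_def sum_2 power2_eq_square)
  then have norm_z: "norm (z s) = 1" for s by (simp add: z_def cmod_def)
  have "z s \<noteq> 0" for s using norm_z[of s] by auto
  have contz: "continuous_on UNIV z"
    unfolding z_def Complex_eq by (intro continuous_intros assms)
  obtain h where h: "continuous_on UNIV h" "\<And>s. z s = exp (h s)"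
    using continuous_logarithm_on_contractible[OF contz contractible_UNIV \<open>z _ \<noteq> 0\<close>]
    by (metis UNIV_I)
  have "exp (Re (h s)) = 1" for s
    using norm_z[of s] by (simp add: h(2))
  then have "z s = cis (Im (h s))" for s by (simp add: h(2) exp_eq_polar)
  then have "U s = direction (Im (h s))" for s
    by (simp add: z_def complex_eq_iff vec_eq_iff forall_2)
  moreover have "continuous_on UNIV (\<lambda>s. Im (h s))" by (intro continuous_intros h)
  ultimately show thesis using that[of "\<lambda>s. Im (h s)"] by blast
qed

section \<open>The isothermal evolution in terms of angles\<close>

lemma normalised_data_has_vector_derivative:
  "normalised_data c v \<Longrightarrow> (c has_vector_derivative vector_derivative c (at s)) (at s)"
  unfolding normalised_data_def C1_immersion_on_def
  by (metis UNIV_I differentiable_on_def vector_derivative_works)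

lemma isothermal_curve_has_vector_derivative:
  assumes "normalised_data c v"
  defines "d \<equiv> \<lambda>s. vector_derivative c (at s)"
  shows "((\<lambda>s. isothermal_curve c v s t) has_vector_derivative
      (1/2) *\<^sub>R ((d (s + t) + v (s + t)) + (d (s - t) - v (s - t)))) (at s)"
proof -
  have v: "continuous_on UNIV v" using assms(1) by (simp add: normalised_data_def)
  have "\<exists>F. \<forall>x. - \<infinity> < ereal x \<longrightarrow> ereal x < \<infinity> \<longrightarrow> (F has_vector_derivative v x) (at x)"
    by (rule einterval_antiderivative)
      (use v in \<open>auto simp: continuous_on_eq_continuous_at\<close>)
  \<comment> \<open>A global antiderivative of \<open>v\<close> turns the oriented integral into a
    difference for endpoints in either order, which covers negative \<open>t\<close>.\<close>
  then obtain F where F: "\<And>x. (F has_vector_derivative v x) (at x)" by auto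
  have int: "(LBINT \<zeta>=ereal a..ereal b. v \<zeta>) = F b - F a" for a b
    by (rule interval_integral_FTC_finite)
      (use v F in \<open>auto intro: continuous_on_subset has_vector_derivative_at_within\<close>)
  have shift: "((\<lambda>s. f (s + r)) has_vector_derivative f' (s + r)) (at s)"
    if "\<And>x. (f has_vector_derivative f' x) (at x)" for f f' :: "real \<Rightarrow> real^2" and r
  proof -
    have "((\<lambda>s. s + r) has_vector_derivative 1) (at s)"
      by (auto intro!: derivative_eq_intros)
    from vector_diff_chain_at[OF this that] show ?thesis by (simp add: o_def)
  qed
  have c: "(c has_vector_derivative d x) (at x)" for x
    unfolding d_def by (rule normalised_data_has_vector_derivative[OF assms(1)])
  show ?thesis
    unfolding isothermal_curve_def int
    using shift[of c d t, OF c] shift[of c d "- t", OF c] shift[of F v t, OF F] shift[of F v "- t", OF F]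
    by (auto intro!: derivative_eq_intros simp: algebra_simps)
qed

lemma isothermal_curve_0 [simp]: "isothermal_curve c v s 0 = c s"
  by (simp add: isothermal_curve_def scaleR_2[symmetric])

text \<open>Orthogonality makes \<open>v\<close> a multiple \<open>k\<close> of the normal to
  \<open>c'\<close>, and normalisation gives \<open>c'\<close> the length
  \<open>sqrt (1 - k^2)\<close>. Since \<open>c'\<close> never vanishes, \<bar>k\<bar> < 1, and
  \<open>\<psi>\<close> is the arcsine of \<open>k\<close>.\<close>

lemma normalised_data_angles:
  fixes c v :: "real \<Rightarrow> real^2"
  assumes nd: "normalised_data c v"
    and \<theta>: "continuous_on UNIV \<theta>" "\<And>s. unit_tangent c s = direction (\<theta> s)"
  obtains \<psi> where "continuous_on UNIV \<psi>" "\<And>s. \<bar>\<psi> s\<bar> < pi / 2"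
    "\<And>s. vector_derivative c (at s) + v s = direction (\<theta> s + \<psi> s)"
    "\<And>s. vector_derivative c (at s) - v s = direction (\<theta> s - \<psi> s)"
proof -
  define d where "d = (\<lambda>s. vector_derivative c (at s))"
  define k where "k = (\<lambda>s. v s \<bullet> direction (\<theta> s + pi / 2))"
  have d: "d s = norm (d s) *\<^sub>R direction (\<theta> s)" for s
    unfolding \<theta>(2)[symmetric] unit_tangent_def d_def by (cases "vector_derivative c (at s) = 0") (simp_all add: sgn_div_norm)
  have d0: "d s \<noteq> 0" for s using nd by (auto simp: normalised_data_def C1_immersion_on_def d_def)
  have "v s \<bullet> direction (\<theta> s) = 0" for s
  proof -
    have "norm (d s) * (direction (\<theta> s) \<bullet> v s) = d s \<bullet> v s" by (metis d inner_scaleR_left)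
    also have "\<dots> = 0" using nd by (simp add: normalised_data_def d_def)
    finally show ?thesis using d0[of s] by (simp add: inner_commute)
  qed
  then have v: "v s = k s *\<^sub>R direction (\<theta> s + pi / 2)" for s
    using direction_expansion[of "v s" "\<theta> s"] by (simp add: k_def)
  then have "norm (v s) = \<bar>k s\<bar>" for s by (metis norm_direction norm_scaleR mult.right_neutral)
  then have sq: "(norm (d s))\<^sup>2 = 1 - (k s)\<^sup>2" for s
    using nd by (simp add: normalised_data_def d_def algebra_simps)
  have k1: "-1 < k s \<and> k s < 1" for s
  proof -
    have "(k s)\<^sup>2 < 1" using sq[of s] d0[of s] by (metis diff_gt_0_iff_gt zero_less_norm_iff zero_less_power)
    then show ?thesis by (simp add: power2_less_1_iff abs_less_iff abs_square_less_1)
  qed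
  have "norm (d s) = cos (arcsin (k s))" for s
    using k1[of s] sq[of s] by (simp add: cos_arcsin) (metis norm_ge_zero real_sqrt_unique)
  then have d': "d s = cos (arcsin (k s)) *\<^sub>R direction (\<theta> s)" for s by (metis d)
  have v': "v s = sin (arcsin (k s)) *\<^sub>R direction (\<theta> s + pi / 2)" for s
    using v k1[of s] by simp
  show thesis
  proof
    have "continuous_on UNIV v" using nd by (simp add: normalised_data_def)
    then have "continuous_on UNIV k"
      unfolding k_def by (intro continuous_intros \<theta>(1))
    then show "continuous_on UNIV (\<lambda>s. arcsin (k s))"
      by (rule continuous_on_arcsin) (simp add: k1 less_imp_le)
    show "\<bar>arcsin (k s)\<bar> < pi / 2" for s
      using arcsin_lt_bounded[of "k s"] k1[of s] unfolding abs_less_iff by linarith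
    show "vector_derivative c (at s) + v s = direction (\<theta> s + arcsin (k s))" for s
      using d'[of s] v'[of s] by (simp only: direction_add[of "\<theta> s" "arcsin (k s)"] d_def)
    show "vector_derivative c (at s) - v s = direction (\<theta> s - arcsin (k s))" for s
      using d'[of s] v'[of s]
      by (simp only: diff_conv_add_uminus direction_add[of "\<theta> s" "- arcsin (k s)"]
          cos_minus sin_minus scaleR_minus_left d_def)
  qed
qed

lemma cos_half_abs_neg:
  fixes x :: real
  assumes "pi < \<bar>x\<bar>" "\<bar>x\<bar> \<le> 2 * pi"
  shows "cos (x / 2) < 0"
proof -
  have "cos (\<bar>x\<bar> / 2) < cos (pi / 2)"
    by (rule cos_monotone_0_pi) (use assms pi_gt_zero in auto)
  moreover have "cos (\<bar>x\<bar> / 2) = cos (x / 2)" by (simp add: abs_if)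
  ultimately show ?thesis by simp
qed

text \<open>Exchanging the arguments of \<open>D\<close> reverses the contribution of
  \<open>\<theta>\<close> but not that of \<open>\<psi>\<close>, so for one order of the two points
  \<open>D\<close> exceeds \<open>pi\<close> in absolute value.\<close>

lemma exists_sign_change:
  fixes \<theta> \<psi> :: "real \<Rightarrow> real"
  assumes cont: "continuous_on UNIV \<theta>" "continuous_on UNIV \<psi>"
    and \<psi>: "\<And>s. \<bar>\<psi> s\<bar> < pi / 2" and arc: "\<theta> s\<^sub>2 - \<theta> s\<^sub>1 > pi"
  shows "\<exists>s t. cos (((\<theta> (s + t) + \<psi> (s + t)) - (\<theta> (s - t) - \<psi> (s - t))) / 2) < 0"
proof -
  define D where "D = (\<lambda>p q. (\<theta> p + \<psi> p) - (\<theta> q - \<psi> q))"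
  obtain p q where pq: "\<bar>D p q\<bar> > pi"
  proof (cases "\<bar>D s\<^sub>2 s\<^sub>1\<bar> > pi")
    case False
    then have "D s\<^sub>2 s\<^sub>1 \<le> pi" by simp
    moreover have "D s\<^sub>2 s\<^sub>1 - D s\<^sub>1 s\<^sub>2 = 2 * (\<theta> s\<^sub>2 - \<theta> s\<^sub>1)" by (simp add: D_def)
    ultimately have "D s\<^sub>1 s\<^sub>2 < - pi" using arc by argo
    then have "\<bar>D s\<^sub>1 s\<^sub>2\<bar> > pi" by simp
    then show thesis by (rule that)
  qed (use that in blast)
  have "continuous_on {0..1} (\<lambda>x. \<bar>D (q + x * (p - q)) q\<bar>)"
    unfolding D_def
    by (intro continuous_intros continuous_on_compose2[OF cont(1)] continuous_on_compose2[OF cont(2)]) auto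
  moreover have "\<bar>D q q\<bar> < pi" using \<psi>[of q] unfolding D_def by linarith
  \<comment> \<open>From \<open>3 * pi\<close> on, the cosine of the half angle may be nonnegative
    again. Moving \<open>p\<close> towards \<open>q\<close>, where the value is below
    \<open>pi\<close>, brings it down to at most \<open>2 * pi\<close>.\<close>
  ultimately have "\<exists>x\<ge>0. x \<le> 1 \<and> \<bar>D (q + x * (p - q)) q\<bar> = min \<bar>D p q\<bar> (2 * pi)"
    using pq pi_gt_zero by (intro IVT') auto
  then obtain r where r: "\<bar>D r q\<bar> = min \<bar>D p q\<bar> (2 * pi)" by blast
  then have "cos (D r q / 2) < 0"
    by (intro cos_half_abs_neg) (use pq pi_gt_zero in \<open>auto simp: min_def\<close>)
  \<comment> \<open>Solving \<open>s + t = r\<close> and \<open>s - t = q\<close> gives the required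
    \<open>s\<close> and \<open>t\<close>.\<close>
  moreover have "(r + q) / 2 + (r - q) / 2 = r" "(r + q) / 2 - (r - q) / 2 = q"
    by (simp_all add: field_simps)
  ultimately have "cos (D ((r + q) / 2 + (r - q) / 2) ((r + q) / 2 - (r - q) / 2) / 2) < 0"
    by (simp only:)
  then show ?thesis unfolding D_def by blast
qed

text \<open>The whole interval would be one fibre, hence countable, although its interior is
  nonempty.\<close>

lemma constant_curve_not_immersed: "\<not> C1_immersed_curve {x}"
proof
  assume "C1_immersed_curve {x}"
  then obtain \<alpha> I where I: "interior I \<noteq> {}" "C1_immersion_on \<alpha> I" "\<alpha> ` I = {x}"
    by (auto simp: C1_immersed_curve_def C1_immersed_parametrisation_def)
  have eq: "I = {u \<in> I. \<alpha> u = x}" using I(3) by blast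
  have "countable I" by (subst eq) (rule countable_fibre_of_immersion[OF I(2)])
  then have "countable (interior I)" by (rule countable_subset[OF interior_subset])
  moreover obtain z e where "e > 0" "ball z e \<subseteq> interior I"
    using I(1) open_interior[of I] unfolding open_contains_ball by blast
  ultimately show False using uncountable_ball[of e z] countable_subset by blast
qed

section \<open>Self-intersections and long arcs\<close>

lemma immersion_angle:
  assumes c: "C1_immersion_on c UNIV"
  obtains \<theta> where "continuous_on UNIV \<theta>" "\<And>s. unit_tangent c s = direction (\<theta> s)"
proof -
  have nz: "vector_derivative c (at s) \<noteq> 0" for s using c by (simp add: C1_immersion_on_def)
  have "continuous_on UNIV (unit_tangent c)"
    using c nz unfolding unit_tangent_def[abs_def] C1_immersion_on_def
    by (auto intro!: continuous_on_sgn)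
  moreover have "norm (unit_tangent c s) = 1" for s
    using nz by (simp add: unit_tangent_def norm_sgn)
  ultimately show thesis using continuous_angle_lift[of "unit_tangent c"] that by blast
qed

text \<open>If the angle stays in an interval of length \<open>pi\<close> centred at \<open>\<mu>\<close>, then \<open>c\<close> advances
  monotonically in the direction \<open>\<mu>\<close>; a self-intersection would force it to run along a straight
  line orthogonal to that direction.\<close>

lemma self_intersection_imp_long_arc:
  fixes c :: "real \<Rightarrow> real^2"
  assumes c: "C1_immersion_on c UNIV" and "\<not> inj c"
  shows "contains_arc_longer_than (unit_tangent c) pi"
proof -
  obtain \<theta> where \<theta>: "continuous_on UNIV \<theta>" "\<And>s. unit_tangent c s = direction (\<theta> s)"
    using immersion_angle[OF c] by blast
  define d where "d = (\<lambda>s. norm (vector_derivative c (at s)))"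
  have dpos: "d s > 0" for s using c by (simp add: d_def C1_immersion_on_def)
  have "vector_derivative c (at s) = d s *\<^sub>R direction (\<theta> s)" for s
    unfolding \<theta>(2)[symmetric] unit_tangent_def d_def
    by (cases "vector_derivative c (at s) = 0") (simp_all add: sgn_div_norm)
  moreover have "(c has_vector_derivative vector_derivative c (at s)) (at s)" for s
    using c unfolding C1_immersion_on_def
    by (metis UNIV_I differentiable_on_def vector_derivative_works)
  ultimately have "(c has_vector_derivative d s *\<^sub>R direction (\<theta> s)) (at s)" for s by simp
  then have "((\<lambda>s. c s \<bullet> direction \<mu>) has_vector_derivative (d s *\<^sub>R direction (\<theta> s)) \<bullet> direction \<mu>) (at s)" for s \<mu>
    by (rule bounded_linear.has_vector_derivative[OF bounded_linear_inner_left])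
  then have deriv: "((\<lambda>s. c s \<bullet> direction \<mu>) has_real_derivative d s * cos (\<theta> s - \<mu>)) (at s)" for s \<mu>
    by (simp add: has_real_derivative_iff_has_vector_derivative inner_direction)
  obtain a b where ab: "a < b" "c a = c b"
    using assms(2) by (auto simp: inj_def) (metis linorder_neqE_linordered_idom)
  have "\<exists>s1 s2. \<theta> s2 - \<theta> s1 > pi"
  proof (rule ccontr)
    assume "\<not> ?thesis"
    then have le: "\<theta> s \<le> \<theta> r + pi" for r s by (simp add: not_less algebra_simps)
    have bdd: "bdd_above (range \<theta>)" using le[of _ 0] by (auto simp: bdd_above_def)
    \<comment> \<open>The angles span at most \<open>pi\<close>, so this centre puts
      \<open>\<theta> - \<mu>\<close> between \<open>- (pi / 2)\<close> and \<open>pi / 2\<close>,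
      where the cosine is nonnegative.\<close>
    define \<mu> where "\<mu> = (SUP s. \<theta> s) - pi / 2"
    have up: "\<theta> s - \<mu> \<le> pi / 2" for s using cSUP_upper[OF _ bdd, of s] by (simp add: \<mu>_def)
    have "(SUP s. \<theta> s) \<le> \<theta> s + pi" for s by (rule cSUP_least) (auto simp: le)
    then have lo: "- (pi / 2) \<le> \<theta> s - \<mu>" for s by (simp add: \<mu>_def algebra_simps)
    have nonneg: "d s * cos (\<theta> s - \<mu>) \<ge> 0" for s
      using dpos[of s] cos_ge_zero[OF lo up] by simp
    have mono: "c x \<bullet> direction \<mu> \<le> c y \<bullet> direction \<mu>" if "x \<le> y" for x y
      using deriv nonneg by (intro DERIV_nonneg_imp_nondecreasing[OF that]) blast
    have zero: "cos (\<theta> s - \<mu>) = 0" if s: "s \<in> {a<..<b}" for s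
    proof -
      \<comment> \<open>A monotone function with equal values at \<open>a\<close> and
        \<open>b\<close> is constant in between.\<close>
      have const: "c x \<bullet> direction \<mu> = c a \<bullet> direction \<mu>" if "x \<in> {a<..<b}" for x
        using mono[of a x] mono[of x b] that ab by simp
      have "((\<lambda>s. c a \<bullet> direction \<mu>) has_real_derivative d s * cos (\<theta> s - \<mu>)) (at s)"
        by (rule DERIV_cong_ev[THEN iffD1, OF refl _ refl deriv[of \<mu> s]])
          (use s const in \<open>auto intro!: eventually_mono[OF eventually_nhds_in_open[of "{a<..<b}" s]]\<close>)
      then have "d s * cos (\<theta> s - \<mu>) = 0" using DERIV_const DERIV_unique by blast
      then show ?thesis using dpos[of s] by simp
    qed
    have "\<theta> s - \<mu> \<in> {pi / 2, - (pi / 2)}" if "s \<in> {a<..<b}" for s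
    proof (rule ccontr)
      assume "\<theta> s - \<mu> \<notin> {pi / 2, - (pi / 2)}"
      then have "cos (\<theta> s - \<mu>) > 0" using up[of s] lo[of s] by (intro cos_gt_zero_pi) auto
      then show False using zero[OF that] by simp
    qed
    then have "(\<lambda>s. \<theta> s - \<mu>) ` {a<..<b} \<subseteq> {pi / 2, - (pi / 2)}" by blast
    then have "countable ((\<lambda>s. \<theta> s - \<mu>) ` {a<..<b})" by (rule countable_subset) simp
    moreover have "continuous_on {a<..<b} (\<lambda>s. \<theta> s - \<mu>)"
      by (intro continuous_intros continuous_on_subset[OF \<theta>(1)]) auto
    ultimately have const: "\<theta> s = \<theta> ((a + b) / 2)" if "s \<in> {a<..<b}" for s
      using constant_on_countable_image[OF connected_Ioo, of a b "\<lambda>s. \<theta> s - \<mu>" s "(a + b) / 2"] that ab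
      by simp
    \<comment> \<open>The angle is constant between \<open>a\<close> and \<open>b\<close>, so
      \<open>c\<close> advances strictly in its own direction and cannot return to
      \<open>c a\<close>.\<close>
    have "c a \<bullet> direction (\<theta> ((a + b) / 2)) < c b \<bullet> direction (\<theta> ((a + b) / 2))"
    proof (rule DERIV_pos_imp_increasing_open[OF ab(1)])
      fix x assume "a < x" "x < b"
      then have "d x * cos (\<theta> x - \<theta> ((a + b) / 2)) > 0" using const[of x] dpos[of x] by simp
      then show "\<exists>y. ((\<lambda>s. c s \<bullet> direction (\<theta> ((a + b) / 2))) has_real_derivative y) (at x) \<and> 0 < y"
        using deriv by blast
    qed (use DERIV_isCont[OF deriv] in \<open>auto intro: continuous_at_imp_continuous_on\<close>)
    then show False using ab by simp
  qed
  then show ?thesis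
    unfolding contains_arc_longer_than_def using \<theta> by (auto simp: direction_def)
qed

section \<open>Assembly of the two implications\<close>

theorem theorem1p7:
  fixes \<phi> :: "real \<times> real \<Rightarrow> spacetime"
    and C V :: "real \<Rightarrow> spacetime"
    and \<gamma> :: "real \<Rightarrow> real \<Rightarrow> real^2"
  assumes "initial_data C V"
    and "isothermal_evolution \<phi> C V"
    and "\<And>s t. \<gamma> s t = snd (\<phi> (s, t))"
  shows "(\<not> inj (\<lambda>s. \<gamma> s 0) \<longrightarrow> contains_arc_longer_than (unit_tangent (\<lambda>s. \<gamma> s 0)) pi) \<and>
    (contains_arc_longer_than (unit_tangent (\<lambda>s. \<gamma> s 0)) pi \<longrightarrow>
      (\<exists>t. \<not> C1_immersed_curve (range (\<lambda>s. \<gamma> s t)) \<or>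
        (C1_immersed_curve (range (\<lambda>s. \<gamma> s t)) \<and>
          \<not> (\<exists>W. unit_tangent_field_along (\<lambda>s. \<gamma> s t) W \<and>
                  extends_unit_tangent (\<lambda>s. \<gamma> s t) W))))"
proof -
  obtain c v where nd: "normalised_data c v" and \<gamma>: "\<And>s t. \<gamma> s t = isothermal_curve c v s t"
    using assms(2,3) by (auto simp: isothermal_evolution_def normal_form_of_def)
  have imm: "C1_immersion_on c UNIV" using nd by (simp add: normalised_data_def)
  have main: "\<exists>t. \<not> C1_immersed_curve (range (\<lambda>s. \<gamma> s t)) \<or>
      (C1_immersed_curve (range (\<lambda>s. \<gamma> s t)) \<and>
        \<not> (\<exists>W. unit_tangent_field_along (\<lambda>s. \<gamma> s t) W \<and> extends_unit_tangent (\<lambda>s. \<gamma> s t) W))"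
    if "contains_arc_longer_than (unit_tangent c) pi"
  proof -
    obtain \<theta> s\<^sub>1 s\<^sub>2 where \<theta>: "continuous_on UNIV \<theta>" "\<And>s. unit_tangent c s = direction (\<theta> s)"
      and arc: "\<theta> s\<^sub>2 - \<theta> s\<^sub>1 > pi"
      using \<open>contains_arc_longer_than _ _\<close> by (auto simp: contains_arc_longer_than_def direction_def)
    obtain \<psi> where \<psi>: "continuous_on UNIV \<psi>" "\<And>s. \<bar>\<psi> s\<bar> < pi / 2"
      and plus: "\<And>s. vector_derivative c (at s) + v s = direction (\<theta> s + \<psi> s)"
      and minus: "\<And>s. vector_derivative c (at s) - v s = direction (\<theta> s - \<psi> s)"
      using normalised_data_angles[OF nd \<theta>] by blast
    define \<alpha> where "\<alpha> = (\<lambda>s. \<theta> s + \<psi> s)"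
    define \<beta> where "\<beta> = (\<lambda>s. \<theta> s - \<psi> s)"
    define m where "m = (\<lambda>s t. cos ((\<alpha> (s + t) - \<beta> (s - t)) / 2))"
    have m: "cos ((\<alpha> (s + t) - \<beta> (s - t)) / 2) = m s t" for s t by (simp add: m_def)
    define E where "E = (\<lambda>s t. direction ((\<alpha> (s + t) + \<beta> (s - t)) / 2))"
    have cont: "continuous_on UNIV \<alpha>" "continuous_on UNIV \<beta>"
      unfolding \<alpha>_def \<beta>_def by (intro continuous_intros \<theta> \<psi>)+
    have deriv: "((\<lambda>s. \<gamma> s t) has_vector_derivative m s t *\<^sub>R E s t) (at s)" for s t
      using isothermal_curve_has_vector_derivative[OF nd, of t s]
      unfolding \<gamma> plus minus direction_add_direction by (simp add: m_def E_def \<alpha>_def \<beta>_def)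
    \<comment> \<open>At \<open>t = 0\<close> the half difference of the angles is
      \<open>\<psi>\<close>, which stays below \<open>pi / 2\<close> in absolute value.\<close>
    have "m 0 0 > 0"
      using \<psi>(2)[of 0] by (simp add: m_def \<alpha>_def \<beta>_def cos_gt_zero_pi abs_less_iff)
    moreover obtain s' t' where "m s' t' < 0"
      using exists_sign_change[OF \<theta>(1) \<psi> arc] by (auto simp: m_def \<alpha>_def \<beta>_def)
    ultimately show ?thesis
    proof (rule exists_transversal_time[OF cont, unfolded m])
      fix t assume null: "\<And>s. m s t = 0"
      then have "((\<lambda>s. \<gamma> s t) has_derivative (\<lambda>h. 0)) (at s)" for s
        using deriv[of t s] by (simp add: has_vector_derivative_def)
      then obtain x where "\<And>s. \<gamma> s t = x"
        using has_derivative_zero_constant[of UNIV "\<lambda>s. \<gamma> s t"] by auto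
      then have "range (\<lambda>s. \<gamma> s t) = {x}" by auto
      then show ?thesis using constant_curve_not_immersed[of x] by (intro exI[of _ t]) simp
    next
      fix t
      assume change: "\<exists>s. m s t > 0" "\<exists>s. m s t < 0"
        and loc: "\<And>s. \<forall>\<^sub>F x in nhds s. m x t = 0 \<Longrightarrow>
          \<exists>T. open T \<and> s \<in> T \<and> (\<forall>x\<in>T. m x t = 0 \<and> \<alpha> (x + t) = \<alpha> (s + t) \<and> \<beta> (x - t) = \<beta> (s - t))"
      obtain r\<^sub>1 r\<^sub>2 where r: "m r\<^sub>1 t > 0" "m r\<^sub>2 t < 0" using change by blast
      have contE: "continuous_on UNIV (\<lambda>s. E s t)"
        unfolding E_def
        by (intro continuous_intros continuous_on_compose2[OF cont(1)] continuous_on_compose2[OF cont(2)]) auto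
      \<comment> \<open>\<open>E\<close> depends on \<open>s\<close> only through
        \<open>\<alpha> (s + t)\<close> and \<open>\<beta> (s - t)\<close>, so it inherits their
        local constancy.\<close>
      have flat: "\<exists>T. open T \<and> s \<in> T \<and> (\<forall>x\<in>T. m x t = 0 \<and> E x t = E s t)"
        if "\<forall>\<^sub>F x in nhds s. m x t = 0" for s
        using loc[OF that] unfolding E_def by metis
      have "\<not> (unit_tangent_field_along (\<lambda>s. \<gamma> s t) W \<and> extends_unit_tangent (\<lambda>s. \<gamma> s t) W)" for W
        using tangent_field_along_no_sign_change[OF deriv contE _ flat _ _ r] by (auto simp: E_def)
      then show ?thesis by blast
    qed
  qed
  have 0: "(\<lambda>s. \<gamma> s 0) = c" by (simp add: \<gamma>)
  show ?thesis
    unfolding 0 by (rule conjI; rule impI; rule self_intersection_imp_long_arc[OF imm] main)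
qed

end
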